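(* The statistical convergence filter $\mathcal{F}_s$ on $\mathbb{N}$ is weak $\ell_1$ complete but does not have the simplified Schur property.
   Context: For $A\subset\mathbb{N}$ the natural density is $\delta(A)=\lim_{n\to\infty} n^{-1}|\{k\le n: k\in A\}|$ (when the limit exists). The statistical convergence filter is $\mathcal{F}_s=\{I\subset\mathbb{N}:\delta(\mathbb{N}\setminus I)=0\}$. For a filter $\mathcal{F}$ on $\mathbb{N}$, a sequence $(x_n)_{n\in\mathbb{N}}$ in a topological space $\mathcal{F}$-converges to $x$ if $\{n: x_n\in U\}\in\mathcal{F}$ for every neighborhood $U$ of $x$. The space $\ell_1$ is the real Banach space of absolutely summable sequences, regarded as a subspace of its bidual $\ell_1^{**}$ via the canonical embedding. A filter $\mathcal{F}$ on $\mathbb{N}$ is weak $\ell_1$ complete (a WC1-filter) if for every norm-bounded sequence $(x_n)\subset\ell_1$ that $\mathcal{F}$-converges in the topology $\sigma(\ell_1^{**},\ell_1^{*})$ to some $x\in\ell_1^{**}$, the limit $x$ in fact belongs to $\ell_1$. $\mathcal{F}$ has the simplified Schur property if for every sequence $(x_n)_{n\in\mathbb{N}}\subset\ell_1$ that converges coordinate-wise to $0$ (in the ordinary sense) and that $\mathcal{F}$-converges to $0$ in the weak topology of $\ell_1$, one has $\mathcal{F}\text{-}\lim\|x_n\|=0$. *)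

theory Defs
  imports "HOL-Analysis.Analysis"
begin

typedef l1 = "{x :: nat \<Rightarrow> real. summable (\<lambda>k. \<bar>x k\<bar>)}"
  morphisms coord Abs_l1
  by (rule exI[of _ "\<lambda>_. 0"]) simp

setup_lifting type_definition_l1

lemma summable_abs_coord: "summable (\<lambda>k. \<bar>coord x k\<bar>)"
  using coord[of x] by simp

instantiation l1 :: real_normed_vector
begin

lift_definition zero_l1 :: l1 is "\<lambda>_. 0"
  by simp

lift_definition plus_l1 :: "l1 \<Rightarrow> l1 \<Rightarrow> l1" is "\<lambda>x y k. x k + y k"
proof -
  fix x y :: "nat \<Rightarrow> real"
  assume "summable (\<lambda>k. \<bar>x k\<bar>)" "summable (\<lambda>k. \<bar>y k\<bar>)"
  then have "summable (\<lambda>k. \<bar>x k\<bar> + \<bar>y k\<bar>)"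
    by (rule summable_add)
  then show "summable (\<lambda>k. \<bar>x k + y k\<bar>)"
    by (rule summable_comparison_test[rotated]) (auto intro: abs_triangle_ineq)
qed

lift_definition uminus_l1 :: "l1 \<Rightarrow> l1" is "\<lambda>x k. - x k"
  by simp

lift_definition minus_l1 :: "l1 \<Rightarrow> l1 \<Rightarrow> l1" is "\<lambda>x y k. x k - y k"
proof -
  fix x y :: "nat \<Rightarrow> real"
  assume "summable (\<lambda>k. \<bar>x k\<bar>)" "summable (\<lambda>k. \<bar>y k\<bar>)"
  then have "summable (\<lambda>k. \<bar>x k\<bar> + \<bar>y k\<bar>)"
    by (rule summable_add)
  then show "summable (\<lambda>k. \<bar>x k - y k\<bar>)"
    by (rule summable_comparison_test[rotated]) (auto intro: abs_triangle_ineq4)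
qed

lift_definition scaleR_l1 :: "real \<Rightarrow> l1 \<Rightarrow> l1" is "\<lambda>c x k. c * x k"
  by (simp add: abs_mult summable_mult)

definition norm_l1 :: "l1 \<Rightarrow> real" where
  "norm_l1 x = (\<Sum>k. \<bar>coord x k\<bar>)"

definition dist_l1 :: "l1 \<Rightarrow> l1 \<Rightarrow> real" where
  "dist_l1 x y = norm (x - y)"

definition sgn_l1 :: "l1 \<Rightarrow> l1" where
  "sgn_l1 x = inverse (norm x) *\<^sub>R x"

definition uniformity_l1 :: "(l1 \<times> l1) filter" where
  "uniformity_l1 = (INF e\<in>{0 <..}. principal {(x, y). dist x y < e})"

definition open_l1 :: "l1 set \<Rightarrow> bool" where
  "open_l1 U \<longleftrightarrow> (\<forall>x\<in>U. eventually (\<lambda>(x', y). x' = x \<longrightarrow> y \<in> U) uniformity)"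

instance
proof
  fix x y z :: l1 and a b :: real and U :: "l1 set"
  show "x + y + z = x + (y + z)" "x + y = y + x" "0 + x = x" "- x + x = 0" "x - y = x + - y"
    "a *\<^sub>R (x + y) = a *\<^sub>R x + a *\<^sub>R y" "(a + b) *\<^sub>R x = a *\<^sub>R x + b *\<^sub>R x"
    "a *\<^sub>R b *\<^sub>R x = (a * b) *\<^sub>R x" "1 *\<^sub>R x = x"
    by (transfer; simp add: algebra_simps)+
  show "dist x y = norm (x - y)"
    by (rule dist_l1_def)
  show "sgn x = inverse (norm x) *\<^sub>R x"
    by (rule sgn_l1_def)
  show "uniformity = (INF e\<in>{0 <..}. principal {(x::l1, y). dist x y < e})"
    by (rule uniformity_l1_def)
  show "open U \<longleftrightarrow> (\<forall>x\<in>U. eventually (\<lambda>(x', y). x' = x \<longrightarrow> y \<in> U) uniformity)"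
    by (rule open_l1_def)
  show "norm x = 0 \<longleftrightarrow> x = 0"
  proof -
    have "norm x = 0 \<longleftrightarrow> (\<forall>k. coord x k = 0)"
      unfolding norm_l1_def by (subst suminf_eq_zero_iff[OF summable_abs_coord]) auto
    also have "\<dots> \<longleftrightarrow> x = 0"
      by transfer auto
    finally show ?thesis .
  qed
  show "norm (x + y) \<le> norm x + norm y"
  proof -
    have "(\<Sum>k. \<bar>coord (x + y) k\<bar>) \<le> (\<Sum>k. \<bar>coord x k\<bar> + \<bar>coord y k\<bar>)"
      by (intro suminf_le summable_add summable_abs_coord) (simp add: plus_l1.rep_eq abs_triangle_ineq)
    also have "\<dots> = norm x + norm y"
      unfolding norm_l1_def by (rule suminf_add[symmetric]; rule summable_abs_coord)
    finally show ?thesis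
      by (simp add: norm_l1_def)
  qed
  show "norm (a *\<^sub>R x) = \<bar>a\<bar> * norm x"
    unfolding norm_l1_def scaleR_l1.rep_eq abs_mult
    by (rule suminf_mult[OF summable_abs_coord])
qed

end

lemma abs_coord_le_norm: "\<bar>coord x k\<bar> \<le> norm x"
proof -
  have "(\<Sum>i\<in>{k}. \<bar>coord x i\<bar>) \<le> (\<Sum>i. \<bar>coord x i\<bar>)"
    by (rule sum_le_suminf[OF summable_abs_coord]) auto
  then show ?thesis
    by (simp add: norm_l1_def)
qed

instance l1 :: banach
proof
  fix X :: "nat \<Rightarrow> l1"
  assume X: "Cauchy X"
  have "Cauchy (\<lambda>n. coord (X n) k)" for k
  proof (rule CauchyI)
    fix e :: real
    assume "0 < e"
    then obtain N where N: "\<And>m n. m \<ge> N \<Longrightarrow> n \<ge> N \<Longrightarrow> norm (X m - X n) < e"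
      using CauchyD[OF X] by blast
    have "norm (coord (X m) k - coord (X n) k) < e" if "m \<ge> N" "n \<ge> N" for m n
      using N[OF that] abs_coord_le_norm[of "X m - X n" k] by (simp add: minus_l1.rep_eq)
    then show "\<exists>N. \<forall>m\<ge>N. \<forall>n\<ge>N. norm (coord (X m) k - coord (X n) k) < e"
      by blast
  qed
  then have "\<forall>k. \<exists>l. (\<lambda>n. coord (X n) k) \<longlonglongrightarrow> l"
    by (simp add: Cauchy_convergent_iff convergent_def)
  then obtain y where y: "\<And>k. (\<lambda>n. coord (X n) k) \<longlonglongrightarrow> y k"
    by metis
  have tail: "\<exists>N. \<forall>n\<ge>N. \<forall>K. (\<Sum>k<K. \<bar>coord (X n) k - y k\<bar>) \<le> e" if e: "0 < e" for e
  proof -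
    obtain N where N: "\<And>m n. m \<ge> N \<Longrightarrow> n \<ge> N \<Longrightarrow> norm (X m - X n) < e"
      using CauchyD[OF X e] by blast
    have "(\<Sum>k<K. \<bar>coord (X n) k - y k\<bar>) \<le> e" if n: "n \<ge> N" for n K
    proof (rule tendsto_upperbound)
      show "(\<lambda>m. \<Sum>k<K. \<bar>coord (X n) k - coord (X m) k\<bar>) \<longlonglongrightarrow> (\<Sum>k<K. \<bar>coord (X n) k - y k\<bar>)"
        by (intro tendsto_intros y)
      have "(\<Sum>k<K. \<bar>coord (X n) k - coord (X m) k\<bar>) \<le> e" if "m \<ge> N" for m
      proof -
        have "(\<Sum>k<K. \<bar>coord (X n - X m) k\<bar>) \<le> norm (X n - X m)"
          unfolding norm_l1_def by (rule sum_le_suminf[OF summable_abs_coord]) auto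
        then show ?thesis
          using N[OF n that] by (simp add: minus_l1.rep_eq)
      qed
      then show "\<forall>\<^sub>F m in sequentially. (\<Sum>k<K. \<bar>coord (X n) k - coord (X m) k\<bar>) \<le> e"
        by (auto simp: eventually_sequentially)
    qed simp
    then show ?thesis
      by blast
  qed
  have summ: "summable (\<lambda>k. \<bar>coord (X n) k - y k\<bar>)"
    if "\<forall>K. (\<Sum>k<K. \<bar>coord (X n) k - y k\<bar>) \<le> e" for n e
    by (rule summableI_nonneg_bounded[where x = e]) (use that in auto)
  obtain M where M: "\<forall>K. (\<Sum>k<K. \<bar>coord (X M) k - y k\<bar>) \<le> 1"
    using tail[of 1] by auto
  have "summable (\<lambda>k. \<bar>y k\<bar>)"
  proof (rule summable_comparison_test)
    show "summable (\<lambda>k. \<bar>coord (X M) k\<bar> + \<bar>coord (X M) k - y k\<bar>)"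
      by (intro summable_add summable_abs_coord summ[OF M])
    show "\<exists>N. \<forall>k\<ge>N. norm \<bar>y k\<bar> \<le> \<bar>coord (X M) k\<bar> + \<bar>coord (X M) k - y k\<bar>"
      by auto
  qed
  then have coord_y: "coord (Abs_l1 y) = y"
    by (simp add: Abs_l1_inverse)
  have "X \<longlonglongrightarrow> Abs_l1 y"
  proof (rule LIMSEQ_I)
    fix r :: real
    assume "0 < r"
    then obtain N where N: "\<forall>n\<ge>N. \<forall>K. (\<Sum>k<K. \<bar>coord (X n) k - y k\<bar>) \<le> r / 2"
      using tail[of "r / 2"] by auto
    have "norm (X n - Abs_l1 y) < r" if "n \<ge> N" for n
    proof -
      have *: "\<forall>K. (\<Sum>k<K. \<bar>coord (X n) k - y k\<bar>) \<le> r / 2"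
        using N that by blast
      have "(\<Sum>k. \<bar>coord (X n) k - y k\<bar>) \<le> r / 2"
        using * by (intro suminf_le_const summ[OF *]) auto
      then show ?thesis
        using \<open>0 < r\<close> by (simp add: norm_l1_def minus_l1.rep_eq coord_y)
    qed
    then show "\<exists>N. \<forall>n\<ge>N. norm (X n - Abs_l1 y) < r"
      by blast
  qed
  then show "convergent X"
    by (auto simp: convergent_def)
qed

text \<open>
  The coarsest topology on the whole type making every functional in \<open>\<Phi>\<close> continuous.
  The topological dual of \<open>'a\<close> is the type \<open>'a \<Rightarrow>\<^sub>L real\<close>.
  Inserting \<open>UNIV\<close> only matters for empty \<open>\<Phi>\<close>, where it keeps the carrier the whole type.
\<close>

definition initial_topology :: "('a \<Rightarrow> real) set \<Rightarrow> 'a topology" where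
  "initial_topology \<Phi> = topology_generated_by (insert UNIV {\<phi> -` U | \<phi> U. \<phi> \<in> \<Phi> \<and> open U})"

text \<open>\<open>\<sigma>(E, E\<^sup>*)\<close>\<close>

definition weak_topology :: "'a::real_normed_vector topology" where
  "weak_topology = initial_topology {\<lambda>x. blinfun_apply f x | f :: 'a \<Rightarrow>\<^sub>L real. True}"

text \<open>\<open>\<sigma>(E\<^sup>*\<^sup>*, E\<^sup>*)\<close>\<close>

definition weak_star_bidual_topology ::
    "(('a::real_normed_vector \<Rightarrow>\<^sub>L real) \<Rightarrow>\<^sub>L real) topology" where
  "weak_star_bidual_topology = initial_topology {\<lambda>z. blinfun_apply z f | f :: 'a \<Rightarrow>\<^sub>L real. True}"

lift_definition canonical_embedding ::
    "'a::real_normed_vector \<Rightarrow> (('a \<Rightarrow>\<^sub>L real) \<Rightarrow>\<^sub>L real)"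
  is "\<lambda>x f. blinfun_apply f x"
  by (rule blinfun.bounded_linear_left)

text \<open>
  The term with \<open>n = 0\<close> is \<open>0\<close> because \<open>x / 0 = 0\<close>, and whether \<open>0\<close> counts as a natural
  number changes the quotients by at most \<open>1/n\<close>; neither affects the limit.
\<close>

definition has_natural_density :: "nat set \<Rightarrow> real \<Rightarrow> bool" where
  "has_natural_density A d \<longleftrightarrow> (\<lambda>n. real (card {k. k \<le> n \<and> k \<in> A}) / real n) \<longlonglongrightarrow> d"

text \<open>
  A set \<open>I\<close> belongs to a filter \<open>F\<close> iff \<open>eventually (\<lambda>n. n \<in> I) F\<close>; see
  \<open>eventually_stat_filter\<close> for the membership characterization.
\<close>

definition stat_filter :: "nat filter" where
  "stat_filter = Abs_filter (\<lambda>P. has_natural_density (- {n. P n}) 0)"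

lemma has_natural_density_zero_mono:
  assumes "has_natural_density B 0" "A \<subseteq> B"
  shows "has_natural_density A 0"
  unfolding has_natural_density_def
proof (rule tendsto_sandwich[where f = "\<lambda>_. 0"])
  show "\<forall>\<^sub>F n in sequentially. real (card {k. k \<le> n \<and> k \<in> A}) / real n
      \<le> real (card {k. k \<le> n \<and> k \<in> B}) / real n"
    using assms(2) by (intro always_eventually allI divide_right_mono) (auto intro!: card_mono)
  show "(\<lambda>n. real (card {k. k \<le> n \<and> k \<in> B}) / real n) \<longlonglongrightarrow> 0"
    using assms(1) by (simp add: has_natural_density_def)
qed auto

lemma has_natural_density_zero_Un:
  assumes "has_natural_density A 0" "has_natural_density B 0"
  shows "has_natural_density (A \<union> B) 0"
  unfolding has_natural_density_def
proof (rule tendsto_sandwich[where f = "\<lambda>_. 0"])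
  have "real (card {k. k \<le> n \<and> k \<in> A \<union> B}) / real n
      \<le> real (card {k. k \<le> n \<and> k \<in> A}) / real n + real (card {k. k \<le> n \<and> k \<in> B}) / real n" for n
  proof -
    have "{k. k \<le> n \<and> k \<in> A \<union> B} = {k. k \<le> n \<and> k \<in> A} \<union> {k. k \<le> n \<and> k \<in> B}"
      by auto
    then have "card {k. k \<le> n \<and> k \<in> A \<union> B} \<le> card {k. k \<le> n \<and> k \<in> A} + card {k. k \<le> n \<and> k \<in> B}"
      by (metis card_Un_le)
    then show ?thesis
      by (simp add: add_divide_distrib[symmetric] divide_right_mono flip: of_nat_add)
  qed
  then show "\<forall>\<^sub>F n in sequentially. real (card {k. k \<le> n \<and> k \<in> A \<union> B}) / real n
      \<le> real (card {k. k \<le> n \<and> k \<in> A}) / real n + real (card {k. k \<le> n \<and> k \<in> B}) / real n"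
    by simp
  show "(\<lambda>n. real (card {k. k \<le> n \<and> k \<in> A}) / real n + real (card {k. k \<le> n \<and> k \<in> B}) / real n)
      \<longlonglongrightarrow> 0"
    using tendsto_add[OF assms[unfolded has_natural_density_def]] by simp
qed auto

lemma eventually_stat_filter:
  "eventually P stat_filter \<longleftrightarrow> has_natural_density (- {n. P n}) 0"
  unfolding stat_filter_def
proof (rule eventually_Abs_filter, rule is_filter.intro)
  show "has_natural_density (- {n. True}) 0"
    by (simp add: has_natural_density_def)
next
  fix P Q :: "nat \<Rightarrow> bool"
  assume "has_natural_density (- {n. P n}) 0" "has_natural_density (- {n. Q n}) 0"
  then have "has_natural_density (- {n. P n} \<union> - {n. Q n}) 0"
    by (rule has_natural_density_zero_Un)
  then show "has_natural_density (- {n. P n \<and> Q n}) 0"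
    by (rule has_natural_density_zero_mono) auto
next
  fix P Q :: "nat \<Rightarrow> bool"
  assume "\<forall>n. P n \<longrightarrow> Q n" "has_natural_density (- {n. P n}) 0"
  then show "has_natural_density (- {n. Q n}) 0"
    by (auto intro: has_natural_density_zero_mono)
qed

lemma stat_filter_neq_bot: "stat_filter \<noteq> bot"
proof
  assume "stat_filter = bot"
  then have "has_natural_density UNIV 0"
    using eventually_stat_filter[of "\<lambda>_. False"] by (simp add: Compl_eq)
  then have "(\<lambda>n. real (Suc n) / real n) \<longlonglongrightarrow> 0"
    by (simp add: has_natural_density_def flip: atMost_def)
  moreover have "\<forall>\<^sub>F n in sequentially. 1 \<le> real (Suc n) / real n"
    by (auto simp: eventually_sequentially field_simps intro!: exI[of _ 1])
  ultimately have "(1::real) \<le> 0"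
    by (rule tendsto_lowerbound) simp
  then show False
    by simp
qed

definition weak_l1_complete :: "nat filter \<Rightarrow> bool" where
  "weak_l1_complete F \<longleftrightarrow>
    (\<forall>(x :: nat \<Rightarrow> l1) z. bounded (range x) \<longrightarrow>
      limitin weak_star_bidual_topology (\<lambda>n. canonical_embedding (x n)) z F \<longrightarrow>
      z \<in> range canonical_embedding)"

definition simplified_Schur_property :: "nat filter \<Rightarrow> bool" where
  "simplified_Schur_property F \<longleftrightarrow>
    (\<forall>x :: nat \<Rightarrow> l1. (\<forall>k. (\<lambda>n. coord (x n) k) \<longlonglongrightarrow> 0) \<longrightarrow>
      limitin weak_topology x 0 F \<longrightarrow>
      ((\<lambda>n. norm (x n)) \<longlongrightarrow> 0) F)"

end

theory Submission
  imports Defs "HOL-Library.Discrete_Functions" "HOL-Real_Asymp.Real_Asymp"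
begin

text \<open>
  A bounded statistically convergent sequence of reals is Cesaro convergent to the same limit.
  Hence the Cesaro means of a bounded sequence in \<open>\<ell>\<^sub>1\<close> that converges statistically in
  \<open>\<sigma>(\<ell>\<^sub>1\<^sup>*\<^sup>*, \<ell>\<^sub>1\<^sup>*)\<close> converge in the ordinary sense in that topology, and the limit lies
  in \<open>\<ell>\<^sub>1\<close> because \<open>\<ell>\<^sub>1\<close>, having the Schur property, is weakly sequentially complete.

  For the failure of the simplified Schur property, take for \<open>n\<close> in the dyadic block
  \<open>{2 ^ m..<2 ^ Suc m}\<close> the normalized \<open>n\<close>-th Rademacher function on \<open>2 ^ 2 ^ Suc m\<close> points,
  a vector of norm \<open>1\<close>. By Bessel's inequality the squares of the values of a functional
  \<open>\<phi>\<close> sum to at most \<open>(norm \<phi>)\<^sup>2\<close> over each block, so the indices up to \<open>n\<close> where the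
  value is at least \<open>\<epsilon>\<close> in modulus are only logarithmically many.
\<close>

section \<open>Convergence in initial topologies\<close>

text \<open>Preimages of open sets form a subbasis, and the sets \<open>V\<close> passing the test
  "\<open>l\<close> in \<open>V\<close> implies eventually \<open>x n\<close> in \<open>V\<close>"
  are closed under finite intersections and arbitrary unions. This reduces both weak topologies to
  scalar limits along \<open>F\<close>.\<close>

lemma limitin_initial_topology:
  "limitin (initial_topology \<Phi>) x l F \<longleftrightarrow> (\<forall>\<phi>\<in>\<Phi>. ((\<lambda>n. \<phi> (x n)) \<longlongrightarrow> \<phi> l) F)"
proof
  assume lim: "limitin (initial_topology \<Phi>) x l F"
  show "\<forall>\<phi>\<in>\<Phi>. ((\<lambda>n. \<phi> (x n)) \<longlongrightarrow> \<phi> l) F"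
  proof (intro ballI topological_tendstoI)
    fix \<phi> U assume "\<phi> \<in> \<Phi>" "open U" "\<phi> l \<in> U"
    then have "openin (initial_topology \<Phi>) (\<phi> -` U)"
      unfolding initial_topology_def by (intro topology_generated_by_Basis) blast
    then show "\<forall>\<^sub>F n in F. \<phi> (x n) \<in> U"
      using lim \<open>\<phi> l \<in> U\<close> unfolding limitin_def by fastforce
  qed
next
  assume conv: "\<forall>\<phi>\<in>\<Phi>. ((\<lambda>n. \<phi> (x n)) \<longlongrightarrow> \<phi> l) F"
  show "limitin (initial_topology \<Phi>) x l F"
    unfolding limitin_def
  proof (intro conjI allI impI)
    show "l \<in> topspace (initial_topology \<Phi>)"
      by (simp add: initial_topology_def topology_generated_by_topspace)
    fix V assume V: "openin (initial_topology \<Phi>) V \<and> l \<in> V"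
    then have "generate_topology_on (insert UNIV {\<phi> -` U | \<phi> U. \<phi> \<in> \<Phi> \<and> open U}) V"
      by (simp add: initial_topology_def openin_topology_generated_by_iff)
    then have "l \<in> V \<longrightarrow> (\<forall>\<^sub>F n in F. x n \<in> V)"
    proof induction
      case (Int A B)
      then show ?case by (auto elim: eventually_elim2)
    next
      case (UN K)
      then show ?case by (auto intro: eventually_mono[of "\<lambda>n. x n \<in> k" for k])
    next
      case (Basis S)
      then show ?case using conv by (auto simp: tendsto_def)
    qed simp
    then show "\<forall>\<^sub>F n in F. x n \<in> V"
      using V by blast
  qed
qed

section \<open>The Schur property of l1\<close>

definition pairing :: "(nat \<Rightarrow> real) \<Rightarrow> l1 \<Rightarrow> real" where
  "pairing f x = (\<Sum>k. f k * coord x k)"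

text \<open>The unit ball of l_infinity as a set of plain functions, so that it can play the role of
  the compact product of intervals [-1, 1].\<close>

definition sup_ball :: "(nat \<Rightarrow> real) set" where
  "sup_ball = {f. \<forall>k. \<bar>f k\<bar> \<le> 1}"

lemma sup_ballD: "f \<in> sup_ball \<Longrightarrow> \<bar>f k\<bar> \<le> 1"
  by (simp add: sup_ball_def)

lemma abs_mult_coord_le: "f \<in> sup_ball \<Longrightarrow> \<bar>f k * coord x k\<bar> \<le> \<bar>coord x k\<bar>"
  by (simp add: abs_mult mult_left_le_one_le sup_ballD)

lemma summable_pairing: "f \<in> sup_ball \<Longrightarrow> summable (\<lambda>k. f k * coord x k)"
  by (rule summable_comparison_test'[OF summable_abs_coord[of x], of 0])
    (simp add: abs_mult_coord_le)

lemma abs_pairing_le: "f \<in> sup_ball \<Longrightarrow> \<bar>pairing f x\<bar> \<le> norm x"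
  unfolding pairing_def norm_l1_def
  by (rule order_trans[OF summable_rabs suminf_le])
    (auto intro: abs_mult_coord_le summable_abs_coord
      summable_comparison_test'[OF summable_abs_coord[of x], of 0] simp: abs_mult_coord_le)

lemma bounded_linear_pairing:
  assumes f: "f \<in> sup_ball"
  shows "bounded_linear (pairing f)"
proof (rule bounded_linear_intro[where K = 1])
  fix x y :: l1 and r :: real
  show "pairing f (x + y) = pairing f x + pairing f y"
    by (simp add: pairing_def plus_l1.rep_eq distrib_left
        suminf_add[OF summable_pairing[OF f] summable_pairing[OF f]])
  show "pairing f (r *\<^sub>R x) = r *\<^sub>R pairing f x"
    using suminf_mult[OF summable_pairing[OF f], of r x]
    by (simp add: pairing_def scaleR_l1.rep_eq mult.left_commute)
  show "norm (pairing f x) \<le> norm x * 1"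
    using abs_pairing_le[OF f] by simp
qed

text \<open>Continuity of \<open>pairing _ x\<close> in the product topology: \<open>g\<close> and
  \<open>f\<close> differ by at most 2 in each entry, so beyond \<open>K\<close> the error is at
  most twice the tail of the norm of \<open>x\<close>.\<close>

lemma pairing_approx_initial_segment:
  assumes f: "f \<in> sup_ball" and \<delta>: "\<delta> > 0"
  obtains K where "\<And>g. g \<in> sup_ball \<Longrightarrow> (\<forall>k<K. g k = f k) \<Longrightarrow> \<bar>pairing g x - pairing f x\<bar> < \<delta>"
proof -
  obtain K where K: "\<And>n. n \<ge> K \<Longrightarrow> norm (\<Sum>i. \<bar>coord x (i + n)\<bar>) < \<delta> / 2"
    using suminf_exist_split[of "\<delta> / 2" "\<lambda>k. \<bar>coord x k\<bar>"] \<delta> summable_abs_coord by auto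
  have summ: "summable (\<lambda>i. \<bar>coord x (i + K)\<bar>)"
    by (rule summable_ignore_initial_segment[OF summable_abs_coord])
  have "\<bar>pairing g x - pairing f x\<bar> < \<delta>" if g: "g \<in> sup_ball" and eq: "\<forall>k<K. g k = f k" for g
  proof -
    have sd: "summable (\<lambda>k. (g k - f k) * coord x k)"
      using summable_diff[OF summable_pairing[OF g] summable_pairing[OF f]]
      by (simp add: left_diff_distrib)
    have le: "\<bar>(g k - f k) * coord x k\<bar> \<le> 2 * \<bar>coord x k\<bar>" for k
      using sup_ballD[OF f, of k] sup_ballD[OF g, of k]
      by (auto simp: abs_mult intro!: mult_right_mono)
    have sa: "summable (\<lambda>i. \<bar>(g (i + K) - f (i + K)) * coord x (i + K)\<bar>)"
      using le by (intro summable_comparison_test'[OF summable_mult[OF summ, of 2], of 0]) simp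
    have "pairing g x - pairing f x = (\<Sum>k. (g k - f k) * coord x k)"
      using suminf_diff[OF summable_pairing[OF g] summable_pairing[OF f]]
      by (simp add: pairing_def left_diff_distrib)
    also have "\<dots> = (\<Sum>i. (g (i + K) - f (i + K)) * coord x (i + K))"
      by (subst suminf_split_initial_segment[OF sd, of K]) (simp add: eq)
    also have "\<bar>\<dots>\<bar> \<le> (\<Sum>i. \<bar>(g (i + K) - f (i + K)) * coord x (i + K)\<bar>)"
      by (rule summable_rabs[OF sa])
    also have "\<dots> \<le> (\<Sum>i. 2 * \<bar>coord x (i + K)\<bar>)"
      by (rule suminf_le[OF le sa summable_mult[OF summ]])
    also have "\<dots> = 2 * (\<Sum>i. \<bar>coord x (i + K)\<bar>)"
      by (rule suminf_mult[OF summ])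
    also have "\<dots> < \<delta>"
      using K[of K] by simp
    finally show ?thesis .
  qed
  then show ?thesis by (rule that)
qed

text \<open>The gliding hump, phrased as a Baire category argument on the compact space \<^term>\<open>sup_ball\<close>:
  some cylinder set is contained in \<open>{f. \<forall>j\<ge>K. \<bar>pairing f (v j)\<bar> \<le> \<epsilon>}\<close>.\<close>

lemma gliding_hump:
  fixes v :: "nat \<Rightarrow> l1"
  assumes null: "\<And>f. f \<in> sup_ball \<Longrightarrow> (\<lambda>j. pairing f (v j)) \<longlonglongrightarrow> 0" and \<epsilon>: "\<epsilon> > 0"
  obtains f K where "f \<in> sup_ball"
    "\<And>g j. g \<in> sup_ball \<Longrightarrow> \<forall>k<K. g k = f k \<Longrightarrow> j \<ge> K \<Longrightarrow> \<bar>pairing g (v j)\<bar> \<le> \<epsilon>"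
proof (rule ccontr)
  note found = that
  assume "\<not> thesis"
  then have fail: "\<exists>g j. g \<in> sup_ball \<and> (\<forall>k<K. g k = f k) \<and> j \<ge> K \<and> \<bar>pairing g (v j)\<bar> > \<epsilon>"
    if "f \<in> sup_ball" for f K
    using found[OF that, of K] not_le by blast
  \<comment> \<open>A pair \<open>(f, K)\<close> stands for the cylinder of all \<open>g\<close>
    agreeing with \<open>f\<close> below \<open>K\<close>. \<open>Q\<close> passes to a smaller
    cylinder on which one fixed, late \<open>v j\<close> keeps its pairing above \<epsilon> in
    modulus.\<close>
  define Q where "Q = (\<lambda>(f, K) (f', K'). K < K' \<and> (\<forall>k<K. f' k = f k) \<and>
    (\<exists>j\<ge>K. \<forall>g\<in>sup_ball. (\<forall>k<K'. g k = f' k) \<longrightarrow> \<bar>pairing g (v j)\<bar> > \<epsilon>))"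
  have step: "\<exists>s'. fst s' \<in> sup_ball \<and> Q s s'" if "fst s \<in> sup_ball" for s :: "(nat \<Rightarrow> real) \<times> nat"
  proof -
    obtain f K where s: "s = (f, K)" by force
    obtain f' j where f': "f' \<in> sup_ball" "\<forall>k<K. f' k = f k" "j \<ge> K" "\<bar>pairing f' (v j)\<bar> > \<epsilon>"
      using fail[of f K] \<open>fst s \<in> sup_ball\<close> s by auto
    obtain K0 where K0: "\<And>g. g \<in> sup_ball \<Longrightarrow> (\<forall>k<K0. g k = f' k) \<Longrightarrow>
        \<bar>pairing g (v j) - pairing f' (v j)\<bar> < \<bar>pairing f' (v j)\<bar> - \<epsilon>"
      using pairing_approx_initial_segment[OF f'(1), of "\<bar>pairing f' (v j)\<bar> - \<epsilon>" "v j"] f'(4)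
      by auto
    have "\<forall>g\<in>sup_ball. (\<forall>k<max K0 (Suc K). g k = f' k) \<longrightarrow> \<bar>pairing g (v j)\<bar> > \<epsilon>"
    proof (intro ballI impI)
      fix g assume "g \<in> sup_ball" "\<forall>k<max K0 (Suc K). g k = f' k"
      then show "\<bar>pairing g (v j)\<bar> > \<epsilon>"
        using K0[of g] by auto
    qed
    then show ?thesis
      using f' unfolding s Q_def by (intro exI[of _ "(f', max K0 (Suc K))"]) auto
  qed
  have "\<exists>s. \<forall>i. fst (s i) \<in> sup_ball \<and> Q (s i) (s (Suc i))"
  proof (rule dependent_nat_choice)
    show "\<exists>s :: (nat \<Rightarrow> real) \<times> nat. fst s \<in> sup_ball"
      by (intro exI[of _ "(\<lambda>_. 0, 0)"]) (simp add: sup_ball_def)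
  qed (rule step)
  then obtain s where s: "\<And>i. fst (s i) \<in> sup_ball" "\<And>i. Q (s i) (s (Suc i))"
    by blast
  define f where "f i = fst (s i)" for i
  define K where "K i = snd (s i)" for i
  have fB: "f i \<in> sup_ball" for i
    using s(1) by (simp add: f_def)
  have K_Suc: "K i < K (Suc i)" and f_Suc: "\<And>k. k < K i \<Longrightarrow> f (Suc i) k = f i k"
    and hump: "\<exists>j\<ge>K i. \<forall>g\<in>sup_ball. (\<forall>k<K (Suc i). g k = f (Suc i) k) \<longrightarrow> \<bar>pairing g (v j)\<bar> > \<epsilon>"
    for i
    using s(2)[of i] by (auto simp: Q_def f_def K_def split_beta)
  have "strict_mono K"
    by (simp add: strict_mono_Suc_iff K_Suc)
  then have K_ge: "i \<le> K i" and K_mono: "i \<le> i' \<Longrightarrow> K i \<le> K i'" for i i'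
    by (auto simp: strict_mono_imp_increasing strict_mono_less_eq)
  have agree: "f i' k = f i k" if "i \<le> i'" "k < K i" for i i' k
    using that(1)
  proof (induction i' rule: dec_induct)
    case (step i')
    then show ?case using f_Suc[of k i'] K_mono[of i i'] that(2) by simp
  qed simp
  \<comment> \<open>A point in all the nested cylinders: since \<open>K (Suc k) > k\<close>, entry
    \<open>k\<close> no longer changes from stage \<open>Suc k\<close> on.\<close>
  define g where "g k = f (Suc k) k" for k
  have gB: "g \<in> sup_ball"
    using fB by (auto simp: g_def sup_ball_def)
  have g_eq: "g k = f i k" if "k < K i" for i k
  proof (cases "i \<le> Suc k")
    case True
    then show ?thesis using agree that by (simp add: g_def)
  next
    case False
    then show ?thesis using agree[of "Suc k" i k] K_ge[of "Suc k"] by (simp add: g_def)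
  qed
  obtain J where J: "\<And>j. j \<ge> J \<Longrightarrow> \<bar>pairing g (v j)\<bar> < \<epsilon>"
    using LIMSEQ_D[OF null[OF gB] \<epsilon>] by auto
  obtain j where "j \<ge> K J" "\<bar>pairing g (v j)\<bar> > \<epsilon>"
    using hump[of J] gB g_eq by blast
  then show False
    using J[of j] K_ge[of J] by simp
qed

text \<open>Inside the cylinder from \<open>gliding_hump\<close> the entries from \<open>K\<close>
  on are free, so choosing them as signs recovers the norm of the tail of \<open>v j\<close>; the
  finitely many remaining coordinates tend to zero.\<close>

theorem l1_Schur:
  fixes v :: "nat \<Rightarrow> l1"
  assumes null: "\<And>\<phi> :: l1 \<Rightarrow>\<^sub>L real. (\<lambda>j. \<phi> (v j)) \<longlonglongrightarrow> 0"
  shows "v \<longlonglongrightarrow> 0"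
proof (rule LIMSEQ_I)
  fix r :: real assume "r > 0"
  have pairing_null: "(\<lambda>j. pairing f (v j)) \<longlonglongrightarrow> 0" if "f \<in> sup_ball" for f
    using null[of "Blinfun (pairing f)"]
    by (simp add: bounded_linear_Blinfun_apply[OF bounded_linear_pairing[OF that]])
  obtain f K where f: "f \<in> sup_ball" and
    fK: "\<And>g j. g \<in> sup_ball \<Longrightarrow> \<forall>k<K. g k = f k \<Longrightarrow> j \<ge> K \<Longrightarrow> \<bar>pairing g (v j)\<bar> \<le> r / 3"
    using gliding_hump[OF pairing_null, of "r / 3"] \<open>r > 0\<close> by auto
  have coord_null: "(\<lambda>j. coord (v j) k) \<longlonglongrightarrow> 0" for k
  proof -
    have "pairing (\<lambda>i. if i = k then 1 else 0) x = coord x k" for x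
      unfolding pairing_def by (subst suminf_finite[of "{k}"]) auto
    then show ?thesis
      using pairing_null[of "\<lambda>i. if i = k then 1 else 0"] by (simp add: sup_ball_def)
  qed
  have "(\<lambda>j. \<Sum>k<K. \<bar>coord (v j) k\<bar>) \<longlonglongrightarrow> (\<Sum>k<K. \<bar>0\<bar>)"
    by (intro tendsto_intros coord_null)
  then obtain J where J: "\<And>j. j \<ge> J \<Longrightarrow> (\<Sum>k<K. \<bar>coord (v j) k\<bar>) < r / 3"
    using LIMSEQ_D[of "\<lambda>j. \<Sum>k<K. \<bar>coord (v j) k\<bar>" 0 "r / 3"] \<open>r > 0\<close> by auto
  have "norm (v j) < r" if j: "j \<ge> max J K" for j
  proof -
    \<comment> \<open>With this \<open>g\<close> the tail is at most \<open>r / 3 + head\<close>, so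
      the norm is at most \<open>r / 3 + 2 * head\<close>, which is below \<open>r\<close>.\<close>
    define g where "g k = (if k < K then f k else sgn (coord (v j) k))" for k
    have g: "g \<in> sup_ball"
      using f by (auto simp: g_def sup_ball_def abs_sgn_eq)
    define head where "head = (\<Sum>k<K. \<bar>coord (v j) k\<bar>)"
    define tail where "tail = (\<Sum>i. \<bar>coord (v j) (i + K)\<bar>)"
    have norm_eq: "norm (v j) = tail + head"
      unfolding norm_l1_def head_def tail_def
      by (rule suminf_split_initial_segment[OF summable_abs_coord])
    have "pairing g (v j) = tail + (\<Sum>k<K. f k * coord (v j) k)"
      unfolding pairing_def tail_def
      by (subst suminf_split_initial_segment[OF summable_pairing[OF g, of "v j"], of K])
        (simp add: g_def mult.commute[of "sgn _"] linordered_idom_class.abs_sgn)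
    moreover have "\<bar>\<Sum>k<K. f k * coord (v j) k\<bar> \<le> head"
      unfolding head_def by (intro order_trans[OF sum_abs] sum_mono abs_mult_coord_le f)
    moreover have "\<bar>pairing g (v j)\<bar> \<le> r / 3"
      using g j by (intro fK) (auto simp: g_def)
    moreover have "head < r / 3"
      using J j by (simp add: head_def)
    ultimately show ?thesis
      using norm_eq by linarith
  qed
  then show "\<exists>N. \<forall>n\<ge>N. norm (v n - 0) < r"
    by (intro exI[of _ "max J K"]) simp
qed

text \<open>If \<open>u\<close> were not Cauchy, differences along two index sequences tending to
  infinity would stay away from zero in norm while being weakly null, against
  \<open>l1_Schur\<close>.\<close>

theorem l1_weakly_sequentially_complete:
  fixes u :: "nat \<Rightarrow> l1" and z :: "(l1 \<Rightarrow>\<^sub>L real) \<Rightarrow> real"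
  assumes lim: "\<And>\<phi>. (\<lambda>n. blinfun_apply \<phi> (u n)) \<longlonglongrightarrow> z \<phi>"
  obtains l where "u \<longlonglongrightarrow> l"
proof -
  have "Cauchy u"
  proof (rule ccontr)
    assume "\<not> Cauchy u"
    then obtain \<epsilon> where \<epsilon>: "\<epsilon> > 0" "\<forall>M. \<exists>m\<ge>M. \<exists>n\<ge>M. \<not> norm (u m - u n) < \<epsilon>"
      unfolding Cauchy_iff by blast
    then obtain p q where pq: "\<And>M. p M \<ge> M" "\<And>M. q M \<ge> M" "\<And>M. \<not> norm (u (p M) - u (q M)) < \<epsilon>"
      by metis
    have "filterlim p sequentially sequentially" "filterlim q sequentially sequentially"
      using pq by (auto intro!: filterlim_at_top_mono[OF filterlim_ident])
    then have "(\<lambda>M. \<phi> (u (p M)) - \<phi> (u (q M))) \<longlonglongrightarrow> z \<phi> - z \<phi>" for \<phi> :: "l1 \<Rightarrow>\<^sub>L real"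
      by (intro tendsto_diff filterlim_compose[OF lim])
    then have "(\<lambda>M. u (p M) - u (q M)) \<longlonglongrightarrow> 0"
      by (intro l1_Schur) (simp add: blinfun.diff_right)
    from LIMSEQ_D[OF this \<epsilon>(1)] show False
      using pq(3) by auto
  qed
  then show ?thesis
    using that by (auto simp: Cauchy_convergent_iff convergent_def)
qed

section \<open>Weak l1 completeness\<close>

text \<open>Deviations from \<open>l\<close> are below \<open>r / 2\<close> off a set of density
  zero and uniformly bounded on it, so the exceptional set contributes nothing to the mean in the
  limit.\<close>

lemma stat_tendsto_imp_Cesaro:
  fixes a :: "nat \<Rightarrow> real"
  assumes lim: "(a \<longlongrightarrow> l) stat_filter" and bdd: "\<And>n. \<bar>a n\<bar> \<le> B"
  shows "(\<lambda>n. (\<Sum>k<n. a k) / n) \<longlonglongrightarrow> l"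
proof (rule LIMSEQ_I)
  fix r :: real assume r: "r > 0"
  define A where "A = {k. \<not> \<bar>a k - l\<bar> < r / 2}"
  define C where "C = B + \<bar>l\<bar>"
  have C: "\<bar>a k - l\<bar> \<le> C" for k
    using bdd[of k] by (simp add: C_def)
  have "\<forall>\<^sub>F k in stat_filter. \<bar>a k - l\<bar> < r / 2"
    using tendstoD[OF lim, of "r / 2"] r by (simp add: dist_real_def)
  then have "has_natural_density A 0"
    by (simp add: eventually_stat_filter A_def Collect_neg_eq)
  then have "(\<lambda>n. C * (real (card {k. k \<le> n \<and> k \<in> A}) / real n)) \<longlonglongrightarrow> C * 0"
    unfolding has_natural_density_def by (intro tendsto_intros)
  then obtain N where N: "\<And>n. n \<ge> N \<Longrightarrow> \<bar>C * (real (card {k. k \<le> n \<and> k \<in> A}) / real n)\<bar> < r / 2"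
    using LIMSEQ_D[of _ "0 :: real" "r / 2"] r by fastforce
  have "norm ((\<Sum>k<n. a k) / n - l) < r" if n: "n \<ge> max N 1" for n
  proof -
    have "\<bar>(\<Sum>k<n. a k) / n - l\<bar> = \<bar>\<Sum>k<n. a k - l\<bar> / n"
      using n by (simp add: sum_subtractf field_simps)
    also have "\<bar>\<Sum>k<n. a k - l\<bar> \<le> (\<Sum>k<n. r / 2 + (if k \<in> A then C else 0))"
      using C r by (intro order_trans[OF sum_abs] sum_mono) (auto simp: A_def intro: add_increasing)
    also have "\<dots> = n * (r / 2) + C * card ({..<n} \<inter> A)"
      by (simp add: sum.distrib sum.If_cases Int_def)
    \<comment> \<open>The mean runs over \<open>k < n\<close> but the density counts
      \<open>k \<le> n\<close>; the enlargement is harmless because \<open>C\<close> is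
      nonnegative.\<close>
    also have "\<dots> \<le> n * (r / 2) + C * card {k. k \<le> n \<and> k \<in> A}"
      using order_trans[OF abs_ge_zero C[of 0]]
      by (intro add_left_mono mult_left_mono) (auto intro!: card_mono)
    finally have "\<bar>(\<Sum>k<n. a k) / n - l\<bar> \<le> (n * (r / 2) + C * card {k. k \<le> n \<and> k \<in> A}) / n"
      by (simp add: divide_right_mono)
    also have "\<dots> = r / 2 + C * (card {k. k \<le> n \<and> k \<in> A} / n)"
      using n by (simp add: add_divide_distrib)
    also have "\<dots> < r"
    proof -
      have "C * (card {k. k \<le> n \<and> k \<in> A} / n) < r / 2"
        by (rule le_less_trans[OF abs_ge_self N]) (use n in simp)
      then show ?thesis by linarith
    qed
    finally show ?thesis by simp
  qed
  then show "\<exists>N. \<forall>n\<ge>N. norm ((\<Sum>k<n. a k) / n - l) < r"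
    by blast
qed

lemma weak_l1_complete_stat_filter: "weak_l1_complete stat_filter"
  unfolding weak_l1_complete_def
proof (intro allI impI)
  fix x :: "nat \<Rightarrow> l1" and z
  assume bdd: "bounded (range x)"
    and lim: "limitin weak_star_bidual_topology (\<lambda>n. canonical_embedding (x n)) z stat_filter"
  obtain B where B: "\<And>n. norm (x n) \<le> B"
    using bdd by (auto simp: bounded_iff)
  define u where "u n = (\<Sum>k<n. x k) /\<^sub>R real n" for n
  have u: "(\<lambda>n. \<phi> (u n)) \<longlonglongrightarrow> z \<phi>" for \<phi> :: "l1 \<Rightarrow>\<^sub>L real"
  proof -
    have "((\<lambda>n. canonical_embedding (x n) \<phi>) \<longlongrightarrow> z \<phi>) stat_filter"
      using lim unfolding weak_star_bidual_topology_def limitin_initial_topology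
      by (auto dest!: bspec[where x = "\<lambda>z. blinfun_apply z \<phi>"])
    then have "((\<lambda>n. \<phi> (x n)) \<longlongrightarrow> z \<phi>) stat_filter"
      by (simp add: canonical_embedding.rep_eq)
    \<comment> \<open>Norm-boundedness of the sequence enters here, as the scalar bound that
      averaging requires.\<close>
    moreover have "\<bar>\<phi> (x n)\<bar> \<le> norm \<phi> * B" for n
      using norm_blinfun[of \<phi> "x n"] mult_left_mono[OF B[of n], of "norm \<phi>"] by simp
    ultimately have "(\<lambda>n. (\<Sum>k<n. \<phi> (x k)) / n) \<longlonglongrightarrow> z \<phi>"
      by (rule stat_tendsto_imp_Cesaro)
    then show ?thesis
      by (simp add: u_def blinfun.scaleR_right blinfun.sum_right divide_inverse mult.commute)
  qed
  then obtain l where "u \<longlonglongrightarrow> l"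
    using l1_weakly_sequentially_complete[where z = "blinfun_apply z"] by blast
  then have "(\<lambda>n. \<phi> (u n)) \<longlonglongrightarrow> \<phi> l" for \<phi> :: "l1 \<Rightarrow>\<^sub>L real"
    by (intro tendsto_intros)
  then have "z = canonical_embedding l"
    by (intro blinfun_eqI) (simp add: canonical_embedding.rep_eq LIMSEQ_unique[OF u])
  then show "z \<in> range canonical_embedding"
    by blast
qed

section \<open>Failure of the simplified Schur property\<close>

lift_definition unit_l1 :: "nat \<Rightarrow> l1" is "\<lambda>i k. if k = i then 1 else 0"
  by (rule summable_finite[of "{i}" for i]) auto

lemma norm_unit_l1: "norm (unit_l1 i) = 1"
  unfolding norm_l1_def unit_l1.rep_eq by (subst suminf_finite[of "{i}"]) auto

lemma coord_sum: "coord (\<Sum>i\<in>A. f i) k = (\<Sum>i\<in>A. coord (f i) k)"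
  by (induction A rule: infinite_finite_induct) (auto simp: zero_l1.rep_eq plus_l1.rep_eq)

text \<open>The sign is read off from binary digit \<open>n\<close> of \<open>k\<close>.\<close>

definition rademacher :: "nat \<Rightarrow> nat \<Rightarrow> real" where
  "rademacher n k = (if even (k div 2 ^ n) then 1 else -1)"

lemma abs_rademacher [simp]: "\<bar>rademacher n k\<bar> = 1"
  by (simp add: rademacher_def)

lemma rademacher_shift:
  assumes "n < N"
  shows "rademacher n (2 ^ N + k) = rademacher n k"
proof -
  have "(2::nat) ^ N = 2 ^ (N - n) * 2 ^ n"
    using assms by (simp flip: power_add)
  then have "(2 ^ N + k) div 2 ^ n = 2 ^ (N - n) + k div 2 ^ n"
    by (simp add: add.commute[of _ k])
  then show ?thesis
    using assms by (simp add: rademacher_def)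
qed

lemma rademacher_less: "k < 2 ^ N \<Longrightarrow> rademacher N k = 1"
  and rademacher_less_shift: "k < 2 ^ N \<Longrightarrow> rademacher N (2 ^ N + k) = -1"
  by (simp_all add: rademacher_def)

lemma sum_lessThan_add:
  fixes g :: "nat \<Rightarrow> real"
  shows "(\<Sum>k<a + b. g k) = (\<Sum>k<a. g k) + (\<Sum>k<b. g (a + k))"
  by (induction b) auto

text \<open>Induction on \<open>N\<close>, splitting the vector into halves \<open>a\<close> and
  \<open>b\<close>: functions with index below \<open>N\<close> see only \<open>a + b\<close>, the
  new one sees only \<open>a - b\<close>, and the parallelogram law adds the two estimates.\<close>

lemma rademacher_Bessel:
  "(\<Sum>n<N. (\<Sum>k<2 ^ N. rademacher n k * a k)\<^sup>2) \<le> 2 ^ N * (\<Sum>k<2 ^ N. (a k)\<^sup>2)"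
proof (induction N arbitrary: a)
  case (Suc N)
  define b where "b k = a (2 ^ N + k)" for k
  have split: "(\<Sum>k<2 ^ Suc N. g k) = (\<Sum>k<2 ^ N. g k) + (\<Sum>k<2 ^ N. g (2 ^ N + k))"
    for g :: "nat \<Rightarrow> real"
    using sum_lessThan_add[of g "2 ^ N" "2 ^ N"] by (simp add: mult_2)
  have low: "(\<Sum>k<2 ^ Suc N. rademacher n k * a k) = (\<Sum>k<2 ^ N. rademacher n k * (a k + b k))"
    if "n < N" for n
    unfolding split using that
    by (simp add: rademacher_shift b_def distrib_left sum.distrib)
  have high: "(\<Sum>k<2 ^ Suc N. rademacher N k * a k) = (\<Sum>k<2 ^ N. a k - b k)"
    unfolding split
    by (simp add: rademacher_less rademacher_less_shift b_def sum_subtractf sum_negf)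
  have parallelogram: "(\<Sum>k<2 ^ N. (a k + b k)\<^sup>2) + (\<Sum>k<2 ^ N. (a k - b k)\<^sup>2)
      = (\<Sum>k<2 ^ N. 2 * (a k)\<^sup>2 + 2 * (b k)\<^sup>2)"
    unfolding sum.distrib[symmetric]
    by (intro sum.cong refl) (simp add: power2_eq_square algebra_simps)
  have "(\<Sum>n<Suc N. (\<Sum>k<2 ^ Suc N. rademacher n k * a k)\<^sup>2)
      = (\<Sum>n<N. (\<Sum>k<2 ^ N. rademacher n k * (a k + b k))\<^sup>2) + (\<Sum>k<2 ^ N. a k - b k)\<^sup>2"
    by (simp only: sum.lessThan_Suc high) (simp add: low del: power_Suc)
  also have "(\<Sum>k<2 ^ N. a k - b k)\<^sup>2 \<le> 2 ^ N * (\<Sum>k<2 ^ N. (a k - b k)\<^sup>2)"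
    using Cauchy_Schwarz_ineq_sum[of "\<lambda>_. 1" "\<lambda>k. a k - b k" "{..<2 ^ N}"] by simp
  also have "(\<Sum>n<N. (\<Sum>k<2 ^ N. rademacher n k * (a k + b k))\<^sup>2) \<le> 2 ^ N * (\<Sum>k<2 ^ N. (a k + b k)\<^sup>2)"
    by (rule Suc.IH)
  also have "2 ^ N * (\<Sum>k<2 ^ N. (a k + b k)\<^sup>2) + 2 ^ N * (\<Sum>k<2 ^ N. (a k - b k)\<^sup>2)
      = 2 ^ N * (\<Sum>k<2 ^ N. 2 * (a k)\<^sup>2 + 2 * (b k)\<^sup>2)"
    by (simp only: distrib_left flip: parallelogram)
  also have "\<dots> = 2 ^ Suc N * (\<Sum>k<2 ^ Suc N. (a k)\<^sup>2)"
    unfolding split by (simp add: b_def sum.distrib sum_distrib_left algebra_simps)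
  finally show ?case by simp
qed simp

section \<open>Normalized Rademacher vectors in \<open>l1\<close>\<close>

definition block_len :: "nat \<Rightarrow> nat" where
  "block_len n = 2 ^ Suc (floor_log n)"

text \<open>\<open>block_len\<close> is constant on each dyadic block, so all vectors of a block
  live on the same points, and it exceeds \<open>n\<close>, so Bessel's inequality covers the index.
  Index 0 lies in no block and gets length 2.\<close>

definition rad_vec :: "nat \<Rightarrow> l1" where
  "rad_vec n = (\<Sum>k<2 ^ block_len n. (rademacher n k / 2 ^ block_len n) *\<^sub>R unit_l1 k)"

lemma coord_rad_vec:
  "coord (rad_vec n) k = (if k < 2 ^ block_len n then rademacher n k / 2 ^ block_len n else 0)"
  by (simp add: rad_vec_def coord_sum scaleR_l1.rep_eq unit_l1.rep_eq if_distrib cong: if_cong)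

lemma norm_rad_vec: "norm (rad_vec n) = 1"
  unfolding norm_l1_def
  by (subst suminf_finite[of "{..<2 ^ block_len n}"]) (auto simp: coord_rad_vec)

lemma less_block_len: "n < block_len n"
  using floor_log_exp2_gt[of n] by (simp add: block_len_def)

text \<open>The unit norm is spread evenly over \<open>2 ^ block_len n\<close> points, so each entry
  is at most \<open>2 ^ -n\<close> in modulus.\<close>

lemma coord_rad_vec_tendsto: "(\<lambda>n. coord (rad_vec n) k) \<longlonglongrightarrow> 0"
proof (rule Lim_null_comparison[of _ "\<lambda>n. inverse (2 ^ n)"])
  show "\<forall>\<^sub>F n in sequentially. norm (coord (rad_vec n) k) \<le> inverse (2 ^ n)"
  proof (intro always_eventually allI)
    fix n
    have "(2::real) ^ n \<le> 2 ^ block_len n"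
      using less_block_len[of n] by (intro power_increasing) auto
    then show "norm (coord (rad_vec n) k) \<le> inverse (2 ^ n)"
      by (simp add: coord_rad_vec field_simps)
  qed
  show "(\<lambda>n. inverse (2 ^ n :: real)) \<longlonglongrightarrow> 0"
    by (rule LIMSEQ_inverse_realpow_zero) simp
qed

text \<open>Bessel's inequality applied to the values of \<phi> on the unit vectors, each at most
  \<open>norm \<phi>\<close> in modulus; the two factors \<open>2 ^ N\<close> cancel against the
  normalization.\<close>

lemma sum_blinfun_rad_vec_block:
  fixes \<phi> :: "l1 \<Rightarrow>\<^sub>L real"
  shows "(\<Sum>n=2 ^ m..<2 ^ Suc m. (\<phi> (rad_vec n))\<^sup>2) \<le> (norm \<phi>)\<^sup>2"
proof -
  define N :: nat where "N = 2 ^ Suc m"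
  define a where "a k = \<phi> (unit_l1 k)" for k
  have a: "(a k)\<^sup>2 \<le> (norm \<phi>)\<^sup>2" for k
    using norm_blinfun[of \<phi> "unit_l1 k"] by (simp add: a_def norm_unit_l1 flip: abs_le_square_iff)
  have "\<phi> (rad_vec n) = (\<Sum>k<2 ^ N. rademacher n k * a k) / 2 ^ N" if "n \<in> {2 ^ m..<2 ^ Suc m}" for n
  proof -
    have "floor_log n = m"
      using that by (intro floor_log_eqI) auto
    then show ?thesis
      by (simp add: rad_vec_def block_len_def N_def a_def blinfun.sum_right blinfun.scaleR_right
          sum_divide_distrib)
  qed
  then have "(\<Sum>n=2 ^ m..<2 ^ Suc m. (\<phi> (rad_vec n))\<^sup>2)
      = (\<Sum>n=2 ^ m..<2 ^ Suc m. ((\<Sum>k<2 ^ N. rademacher n k * a k) / 2 ^ N)\<^sup>2)"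
    by (intro sum.cong refl) (simp only:)
  also have "\<dots> = (\<Sum>n=2 ^ m..<N. (\<Sum>k<2 ^ N. rademacher n k * a k)\<^sup>2) / (2 ^ N)\<^sup>2"
    by (simp add: N_def power_divide flip: sum_divide_distrib)
  \<comment> \<open>The block is enlarged to all indices below \<open>N\<close>, the range of
    Bessel's inequality.\<close>
  also have "\<dots> \<le> (\<Sum>n<N. (\<Sum>k<2 ^ N. rademacher n k * a k)\<^sup>2) / (2 ^ N)\<^sup>2"
    by (intro divide_right_mono sum_mono2) auto
  also have "\<dots> \<le> 2 ^ N * (\<Sum>k<2 ^ N. (a k)\<^sup>2) / (2 ^ N)\<^sup>2"
    by (intro divide_right_mono rademacher_Bessel) simp
  also have "\<dots> \<le> 2 ^ N * (\<Sum>k<(2::nat) ^ N. (norm \<phi>)\<^sup>2) / (2 ^ N)\<^sup>2"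
    by (intro divide_right_mono mult_left_mono sum_mono a) auto
  also have "\<dots> = (norm \<phi>)\<^sup>2"
    by (simp add: power2_eq_square)
  finally show ?thesis .
qed

text \<open>The indices below \<open>2 ^ m\<close> are 0 together with \<open>m\<close> dyadic
  blocks, each contributing at most the squared norm of \<phi>.\<close>

lemma sum_blinfun_rad_vec:
  fixes \<phi> :: "l1 \<Rightarrow>\<^sub>L real"
  shows "(\<Sum>n<2 ^ m. (\<phi> (rad_vec n))\<^sup>2) \<le> real (m + 1) * (norm \<phi>)\<^sup>2"
proof (induction m)
  case 0
  have "(\<phi> (rad_vec 0))\<^sup>2 \<le> (norm \<phi>)\<^sup>2"
    using norm_blinfun[of \<phi> "rad_vec 0"] by (simp add: norm_rad_vec flip: abs_le_square_iff)
  then show ?case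
    by (simp add: lessThan_Suc)
next
  case (Suc m)
  have "(\<Sum>n<2 ^ Suc m. (\<phi> (rad_vec n))\<^sup>2)
      = (\<Sum>n<2 ^ m. (\<phi> (rad_vec n))\<^sup>2) + (\<Sum>n=2 ^ m..<2 ^ Suc m. (\<phi> (rad_vec n))\<^sup>2)"
    unfolding lessThan_atLeast0 by (rule sum.atLeastLessThan_concat[symmetric]) simp_all
  also have "\<dots> \<le> real (m + 1) * (norm \<phi>)\<^sup>2 + (norm \<phi>)\<^sup>2"
    by (intro add_mono Suc.IH sum_blinfun_rad_vec_block)
  finally show ?case
    by (simp add: algebra_simps)
qed

section \<open>Logarithmic counting and density zero\<close>

lemma floor_log_le_log: "n > 0 \<Longrightarrow> real (floor_log n) \<le> log 2 n"
  using floor_log_exp2_le[of n] by (simp add: le_log_iff powr_realpow)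

text \<open>A Chebyshev estimate: each index in \<open>A\<close> adds at least
  \<open>\<epsilon>\<^sup>2\<close> to a sum that grows only logarithmically.\<close>

lemma blinfun_rad_vec_stat_tendsto:
  fixes \<phi> :: "l1 \<Rightarrow>\<^sub>L real"
  shows "((\<lambda>n. \<phi> (rad_vec n)) \<longlongrightarrow> 0) stat_filter"
proof (rule tendstoI)
  fix \<epsilon> :: real assume \<epsilon>: "\<epsilon> > 0"
  define A where "A = {n. \<not> \<bar>\<phi> (rad_vec n)\<bar> < \<epsilon>}"
  define c where "c = (norm \<phi>)\<^sup>2 / \<epsilon>\<^sup>2"
  have c: "c \<ge> 0"
    by (simp add: c_def)
  have card_le: "real (card {k. k \<le> n \<and> k \<in> A}) \<le> real (floor_log n + 2) * c" for n
  proof -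
    \<comment> \<open>Rounding up to the end of the dyadic block of \<open>n\<close> means
      \<open>m = floor_log n + 1\<close>, whence the factor \<open>floor_log n + 2\<close>.\<close>
    have sub: "{k. k \<le> n \<and> k \<in> A} \<subseteq> {..<2 ^ Suc (floor_log n)}"
      using floor_log_exp2_gt[of n] by auto
    have "card {k. k \<le> n \<and> k \<in> A} * \<epsilon>\<^sup>2 = (\<Sum>k | k \<le> n \<and> k \<in> A. \<epsilon>\<^sup>2)"
      by simp
    also have "\<dots> \<le> (\<Sum>k | k \<le> n \<and> k \<in> A. (\<phi> (rad_vec k))\<^sup>2)"
      using \<epsilon> by (intro sum_mono) (auto simp: A_def simp flip: abs_le_square_iff)
    also have "\<dots> \<le> (\<Sum>k<2 ^ Suc (floor_log n). (\<phi> (rad_vec k))\<^sup>2)"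
      by (rule sum_mono2[OF _ sub]) auto
    also have "\<dots> \<le> real (floor_log n + 2) * (norm \<phi>)\<^sup>2"
      using sum_blinfun_rad_vec[of \<phi> "Suc (floor_log n)"] by (simp add: algebra_simps)
    finally show ?thesis
      using \<epsilon> by (simp add: c_def field_simps)
  qed
  have "has_natural_density A 0"
    unfolding has_natural_density_def
  proof (rule Lim_null_comparison)
    show "\<forall>\<^sub>F n in sequentially. norm (real (card {k. k \<le> n \<and> k \<in> A}) / n) \<le> (log 2 n + 2) / n * c"
      using eventually_gt_at_top[of 0]
    proof eventually_elim
      case (elim n)
      have "real (card {k. k \<le> n \<and> k \<in> A}) \<le> (log 2 n + 2) * c"
        using card_le[of n] mult_right_mono[OF floor_log_le_log[OF elim] c]
        by (simp add: algebra_simps)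
      then show ?case
        by (simp add: divide_right_mono)
    qed
    have "(\<lambda>n. (log 2 (real n) + 2) / n) \<longlonglongrightarrow> 0"
      by real_asymp
    then show "(\<lambda>n. (log 2 (real n) + 2) / n * c) \<longlonglongrightarrow> 0"
      by (rule tendsto_mult_left_zero)
  qed
  then show "\<forall>\<^sub>F n in stat_filter. dist (\<phi> (rad_vec n)) 0 < \<epsilon>"
    by (simp add: eventually_stat_filter A_def Collect_neg_eq)
qed

lemma not_simplified_Schur_property_stat_filter: "\<not> simplified_Schur_property stat_filter"
proof
  assume "simplified_Schur_property stat_filter"
  moreover have "limitin weak_topology rad_vec 0 stat_filter"
    unfolding weak_topology_def limitin_initial_topology
    using blinfun_rad_vec_stat_tendsto by (auto simp: blinfun.zero_right)
  ultimately have "((\<lambda>n. norm (rad_vec n)) \<longlongrightarrow> 0) stat_filter"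
    using coord_rad_vec_tendsto unfolding simplified_Schur_property_def by blast
  \<comment> \<open>The norms are constantly 1, and a constant has no other limit along a proper
    filter.\<close>
  then show False
    using stat_filter_neq_bot by (simp add: norm_rad_vec tendsto_const_iff)
qed

theorem theorem5p3:
  shows "weak_l1_complete stat_filter \<and> \<not> simplified_Schur_property stat_filter"
  using weak_l1_complete_stat_filter not_simplified_Schur_property_stat_filter by blast

end
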